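(* Let $n,M\ge1$ be integers and let $x_1,\ldots,x_n,m$ be nonnegative integers. Let $A_{M}(x_1,\ldots,x_n;m)$ denote the number of $n$-tuples $(\mu_1,\ldots,\mu_n)$, where each $\mu_r$ is a partition into $x_r$ distinct parts, $\mu_1$ is a partition into parts differing by at least $M$, and the sum of all of the parts of all the $\mu_r$ is $m$. Let $B_{M}(x_1,\ldots,x_n;m)$ denote the number of colored partitions $\lambda_1+\cdots+\lambda_s$ of $m$ counted by $B(x_1,\ldots,x_n;m)$ (defined in the context) such that if $\lambda_i\ge\lambda_j$ (with $i<j$) are any two parts with odd color, then $$\lambda_i-\lambda_j\ge M+\sum_{\ell=i}^{j-1}\omega_e(c_\ell).$$ Then $A_{M}(x_1,\ldots,x_n;m)=B_{M}(x_1,\ldots,x_n;m)$.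
   Context: All parts of partitions are positive integers; the empty partition is allowed. In a colored partition each part is a positive integer (its size) together with a color, and the parts are written in decreasing order $\lambda_1,\ldots,\lambda_s$, ordered first by size and then by color; "distinct" means that no (size, color) pair is repeated. In inequalities $\lambda_i$ denotes the size of the $i$-th part and $c_i$ its color. For a positive integer $c$: $\omega(c)$ is the number of powers of $2$ occurring in the binary representation of $c$; $\omega_e(c)$ is the number of even powers of $2$, i.e. those among $2,4,8,\ldots$ (all powers of $2$ other than $1$), occurring in the binary representation of $c$; $v(c)$ (resp. $z(c)$) is the smallest (resp. largest) power of $2$ occurring in the binary representation of $c$. The function $\delta(c,d)$ equals $1$ if $z(c)<v(d)$ and $0$ otherwise. $B(x_1,\ldots,x_n;m)$ denotes the number of partitions $\lambda_1+\cdots+\lambda_s$ of $m$ into distinct parts occurring in $2^n-1$ colors ($c_i\in\{1,\ldots,2^n-1\}$) such that $\lambda_s\ge\omega(c_s)$; for each $1\le r\le n$ exactly $x_r$ of the colors $c_i$ have $2^{r-1}$ in their binary representations; and $\lambda_i-\lambda_{i+1}\ge\omega(c_i)+\delta(c_i,c_{i+1})$ for all $1\le i<s$. *)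

theory Defs
  imports Main
begin

text \<open>Partitions are the lists of their parts in decreasing order. Lists are indexed from 0,
  so the part written \<open>\<lambda>\<^sub>i\<close> on paper is entry \<open>i - 1\<close> of the list.\<close>

definition is_partition :: "nat list \<Rightarrow> bool" where
  "is_partition \<mu> \<longleftrightarrow> sorted_wrt (\<ge>) \<mu> \<and> (\<forall>p \<in> set \<mu>. p > 0)"

definition parts_differ_by :: "nat \<Rightarrow> nat list \<Rightarrow> bool" where
  "parts_differ_by M \<mu> \<longleftrightarrow> (\<forall>i j. i < j \<and> j < length \<mu> \<longrightarrow> \<mu> ! i \<ge> \<mu> ! j + M)"

text \<open>The component \<open>\<mu>\<^sub>r\<close> of an \<open>n\<close>-tuple is entry \<open>r - 1\<close>. The argument \<open>x\<close> is only ever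
  evaluated at \<open>1, \<dots>, n\<close>.\<close>

definition A_set :: "nat \<Rightarrow> nat \<Rightarrow> (nat \<Rightarrow> nat) \<Rightarrow> nat \<Rightarrow> nat list list set" where
  "A_set n M x m = {\<mu>s. length \<mu>s = n
     \<and> (\<forall>r \<in> {1..n}. is_partition (\<mu>s ! (r - 1)) \<and> distinct (\<mu>s ! (r - 1))
                     \<and> length (\<mu>s ! (r - 1)) = x r)
     \<and> parts_differ_by M (\<mu>s ! 0)
     \<and> (\<Sum>r = 1..n. sum_list (\<mu>s ! (r - 1))) = m}"

definition A_count :: "nat \<Rightarrow> nat \<Rightarrow> (nat \<Rightarrow> nat) \<Rightarrow> nat \<Rightarrow> nat" where
  "A_count n M x m = card (A_set n M x m)"

definition bin_powers :: "nat \<Rightarrow> nat set" where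
  "bin_powers c = {2 ^ k |k. bit c k}"

definition \<omega> :: "nat \<Rightarrow> nat" where
  "\<omega> c = card (bin_powers c)"

definition \<omega>\<^sub>e :: "nat \<Rightarrow> nat" where
  "\<omega>\<^sub>e c = card {p \<in> bin_powers c. even p}"

definition v :: "nat \<Rightarrow> nat" where
  "v c = Min (bin_powers c)"

definition z :: "nat \<Rightarrow> nat" where
  "z c = Max (bin_powers c)"

definition \<delta> :: "nat \<Rightarrow> nat \<Rightarrow> nat" where
  "\<delta> c d = (if z c < v d then 1 else 0)"

type_synonym colored_part = "nat \<times> nat"

abbreviation part_size :: "colored_part \<Rightarrow> nat" where "part_size \<equiv> fst"
abbreviation part_color :: "colored_part \<Rightarrow> nat" where "part_color \<equiv> snd"

definition colored_ge :: "colored_part \<Rightarrow> colored_part \<Rightarrow> bool" where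
  "colored_ge p q \<longleftrightarrow> part_size p > part_size q
     \<or> part_size p = part_size q \<and> part_color p \<ge> part_color q"

definition is_colored_partition :: "nat \<Rightarrow> colored_part list \<Rightarrow> bool" where
  "is_colored_partition N L \<longleftrightarrow> sorted_wrt colored_ge L
     \<and> (\<forall>p \<in> set L. part_size p > 0 \<and> part_color p \<in> {1..N})"

text \<open>Lower bounds on differences of sizes are written additively because subtraction
  on \<open>nat\<close> truncates.\<close>

definition B_set :: "nat \<Rightarrow> (nat \<Rightarrow> nat) \<Rightarrow> nat \<Rightarrow> colored_part list set" where
  "B_set n x m = {L. is_colored_partition (2 ^ n - 1) L \<and> distinct L
     \<and> sum_list (map part_size L) = m
     \<and> (L \<noteq> [] \<longrightarrow> part_size (last L) \<ge> \<omega> (part_color (last L)))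
     \<and> (\<forall>r \<in> {1..n}.
          card {i. i < length L \<and> 2 ^ (r - 1) \<in> bin_powers (part_color (L ! i))} = x r)
     \<and> (\<forall>i. i + 1 < length L \<longrightarrow>
          part_size (L ! i) \<ge> part_size (L ! (i + 1)) + \<omega> (part_color (L ! i))
            + \<delta> (part_color (L ! i)) (part_color (L ! (i + 1))))}"

definition BM_set :: "nat \<Rightarrow> nat \<Rightarrow> (nat \<Rightarrow> nat) \<Rightarrow> nat \<Rightarrow> colored_part list set" where
  "BM_set n M x m = {L \<in> B_set n x m.
     \<forall>i j. i < j \<and> j < length L \<and> part_size (L ! i) \<ge> part_size (L ! j)
         \<and> odd (part_color (L ! i)) \<and> odd (part_color (L ! j)) \<longrightarrow>
       part_size (L ! i) \<ge> part_size (L ! j) + M + (\<Sum>l = i..<j. \<omega>\<^sub>e (part_color (L ! l)))}"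

definition BM_count :: "nat \<Rightarrow> nat \<Rightarrow> (nat \<Rightarrow> nat) \<Rightarrow> nat \<Rightarrow> nat" where
  "BM_count n M x m = card (BM_set n M x m)"

end

theory Submission
  imports Defs "HOL-Computational_Algebra.Polynomial"
begin

text \<open>
Both sides are counted by words. Fix a letter \<open>N \<ge> n\<close>, the \<^emph>\<open>bar\<close>, and consider words over
\<open>{0, \<dots>, n - 1} \<union> {N}\<close>, where the letter \<open>k < n\<close> stands for the power \<open>2 ^ k\<close>. Cut a word into
runs: a new run starts at a letter \<open>b < N\<close> that is preceded by a letter \<open>\<ge> b\<close> (a bar is always
imagined in front of the word). A run is an increasing sequence of letters below \<open>N\<close> followed by
bars; the set of its letters below \<open>N\<close> is the binary representation of a color \<open>c\<close>. Give the
run the size \<open>\<lambda>\<close> that is the length of the suffix of the word starting with it. Then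
\<open>\<lambda>\<^sub>i - \<lambda>\<^sub>i\<^sub>+\<^sub>1\<close> is \<open>\<omega>(c\<^sub>i)\<close> plus the number of bars of run \<open>i\<close>, and at least one bar is needed
exactly when the letters of run \<open>i\<close> and those of run \<open>i + 1\<close> would otherwise merge into one
increasing run, that is when \<open>\<delta>(c\<^sub>i, c\<^sub>i\<^sub>+\<^sub>1) = 1\<close>. So words of a given length correspond to the
colored partitions counted by \<open>B\<close> (\<open>card_words\<close>), the length being irrelevant once it is large,
because it only changes the number of leading bars. The sum of the parts becomes the
sum over the run starts of the remaining lengths: a major index.

As for Carlitz's insertion proof of the distribution of the major index, the letters can be
inserted one after the other in increasing order. If \<open>t\<close> copies of a letter \<open>r\<close> larger than all letters
of \<open>w\<close> other than the bar are inserted in all possible ways into a word \<open>w\<close> of length \<open>l\<close>, the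
increments of the major index are distributed as the sums of \<open>t\<close> distinct elements of
\<open>{1, \<dots>, l + t}\<close>, whatever \<open>w\<close> is (\<open>sum_insertions\<close>). This is the generating function of the
partitions \<open>\<mu>\<^sub>r\<close>, as long as \<open>l\<close> is large.

The condition involving \<open>M\<close> survives all the insertions. If \<open>c\<^sub>j\<close> is odd then the run \<open>j\<close> starts with a
letter \<open>0\<close>, and subtracting from \<open>\<lambda>\<^sub>j\<close> the numbers \<open>\<omega>\<^sub>e(c\<^sub>l)\<close> for all \<open>l \<ge> j\<close> removes from the
length of the suffix all its letters other than \<open>0\<close> and the bar. Hence the condition says that in
the subword of zeros and bars the lengths of the suffixes that start with a zero differ by at
least \<open>M\<close>. Insertions of the letters \<open>1, \<dots>, n - 1\<close> do not affect this subword, and those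
lengths are the parts of \<open>\<mu>\<^sub>1\<close>. So the theorem follows by induction on \<open>n\<close>, the case
\<open>n = 1\<close> being immediate.
\<close>

section \<open>Partitions into distinct bounded parts\<close>

text \<open>The elementary symmetric polynomial of degree \<open>t\<close> in \<open>1, q, \<dots>, q ^ (h - 1)\<close>, which is
  \<open>q ^ (t choose 2)\<close> times a \<open>q\<close>-binomial coefficient. The recursion separates the products
  with and without the factor \<open>q ^ (h - 1)\<close>.\<close>
fun power_esym :: "'a::comm_semiring_1 \<Rightarrow> nat \<Rightarrow> nat \<Rightarrow> 'a" where
  "power_esym q h 0 = 1"
| "power_esym q 0 (Suc t) = 0"
| "power_esym q (Suc h) (Suc t) = power_esym q h (Suc t) + q ^ h * power_esym q h t"

text \<open>The dual recursion separates the products with and without the factor \<open>1\<close>; the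
  other exponents are all at least \<open>1\<close>, which gives the powers of \<open>q\<close>.\<close>
lemma power_esym_Suc_Suc_least:
  "power_esym q (Suc h) (Suc t) = q ^ Suc t * power_esym q h (Suc t) + q ^ t * power_esym q h t"
proof (induction h arbitrary: t)
  case 0
  show ?case by (cases t) auto
next
  case (Suc h)
  show ?case
  proof (cases t)
    case 0
    have "power_esym q (Suc (Suc h)) (Suc 0) = power_esym q (Suc h) (Suc 0) + q ^ Suc h"
      by simp
    also have "\<dots> = (q * power_esym q h (Suc 0) + 1) + q ^ Suc h"
      using Suc.IH[of 0] by (simp only: power_esym.simps power_Suc power_0 mult_1_left mult_1_right)
    also have "\<dots> = q * power_esym q (Suc h) (Suc 0) + 1"
      unfolding power_esym.simps(3) by (simp add: algebra_simps)
    finally show ?thesis using 0 by simp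
  next
    case (Suc s)
    have "power_esym q (Suc (Suc h)) (Suc t)
        = power_esym q (Suc h) (Suc t) + q ^ Suc h * power_esym q (Suc h) t"
      by (simp only: power_esym.simps)
    also have "\<dots> = (q ^ Suc t * power_esym q h (Suc t) + q ^ t * power_esym q h t)
        + q ^ Suc h * (q ^ t * power_esym q h t + q ^ s * power_esym q h s)"
      using Suc.IH[of t] Suc.IH[of s] Suc by (simp only:)
    also have "\<dots> = q ^ Suc t * power_esym q (Suc h) (Suc t) + q ^ t * power_esym q (Suc h) t"
      unfolding Suc power_esym.simps(3) by (simp add: algebra_simps)
    finally show ?thesis .
  qed
qed

definition strict_lists :: "nat \<Rightarrow> nat \<Rightarrow> nat list set" where
  "strict_lists h t = {\<mu>. length \<mu> = t \<and> sorted_wrt (>) \<mu> \<and> set \<mu> \<subseteq> {1..h}}"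

lemma finite_strict_lists: "finite (strict_lists h t)"
  by (rule finite_subset[OF _ finite_lists_length_eq[of "{1..h}" t]]) (auto simp: strict_lists_def)

lemma strict_lists_0: "strict_lists h 0 = {[]}"
  by (auto simp: strict_lists_def)

lemma strict_lists_0_Suc: "strict_lists 0 (Suc t) = {}"
  by (auto simp: strict_lists_def)

lemma strict_lists_Suc_Suc:
  "strict_lists (Suc h) (Suc t) = strict_lists h (Suc t) \<union> (#) (Suc h) ` strict_lists h t"
proof (intro equalityI subsetI)
  fix \<mu> assume mu: "\<mu> \<in> strict_lists (Suc h) (Suc t)"
  then obtain a \<nu> where \<mu>: "\<mu> = a # \<nu>" by (cases \<mu>) (auto simp: strict_lists_def)
  show "\<mu> \<in> strict_lists h (Suc t) \<union> (#) (Suc h) ` strict_lists h t"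
  proof (cases "a = Suc h")
    case True
    then have "\<nu> \<in> strict_lists h t" using mu unfolding \<mu>
      by (auto simp: strict_lists_def less_Suc_eq_le)
    then show ?thesis using \<mu> True by auto
  next
    case False
    then have "\<mu> \<in> strict_lists h (Suc t)" using mu unfolding \<mu>
      by (force simp: strict_lists_def)
    then show ?thesis by auto
  qed
qed (fastforce simp: strict_lists_def)

text \<open>The shift from parts in \<open>{1..h}\<close> to exponents in \<open>{0..<h}\<close> accounts for the factor \<open>q ^ t\<close>.\<close>
lemma sum_strict_lists:
  "(\<Sum>\<mu>\<in>strict_lists h t. q ^ sum_list \<mu>) = q ^ t * power_esym q h t"
proof (induction q h t rule: power_esym.induct)
  case (3 q h t)
  have "(\<Sum>\<mu>\<in>strict_lists (Suc h) (Suc t). q ^ sum_list \<mu>)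
      = (\<Sum>\<mu>\<in>strict_lists h (Suc t). q ^ sum_list \<mu>)
        + (\<Sum>\<mu>\<in>(#) (Suc h) ` strict_lists h t. q ^ sum_list \<mu>)"
    unfolding strict_lists_Suc_Suc
    by (rule sum.union_disjoint) (auto simp: finite_strict_lists, auto simp: strict_lists_def)
  also have "(\<Sum>\<mu>\<in>(#) (Suc h) ` strict_lists h t. q ^ sum_list \<mu>)
      = q ^ Suc h * (\<Sum>\<mu>\<in>strict_lists h t. q ^ sum_list \<mu>)"
    by (simp add: sum.reindex sum_distrib_left power_add mult.assoc)
  finally show ?case using 3 by (simp add: algebra_simps)
qed (auto simp: strict_lists_0 strict_lists_0_Suc)

section \<open>Inserting copies of a letter into a word\<close>

text \<open>A \<^emph>\<open>break\<close> of a word is a place between two letters \<open>a\<close>, \<open>b\<close> with \<open>b \<le> a\<close> and \<open>b < N\<close>. Each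
  break contributes the number of letters to its right, so this is a major index that counts
  positions from the right and takes all weak descents except those of the bar against itself.\<close>
fun break_weight :: "nat \<Rightarrow> nat list \<Rightarrow> nat" where
  "break_weight N [] = 0"
| "break_weight N (a # w) =
    (if w \<noteq> [] \<and> hd w \<le> a \<and> hd w < N then length w else 0) + break_weight N w"

text \<open>The words obtained from \<open>w\<close> by inserting \<open>t\<close> copies of \<open>r\<close>, provided that \<open>r\<close> does not
  occur in \<open>w\<close>.\<close>
definition insertions :: "nat \<Rightarrow> nat list \<Rightarrow> nat \<Rightarrow> nat list set" where
  "insertions r w t = {u. filter (\<lambda>a. a \<noteq> r) u = w \<and> length u = length w + t}"

lemma insertions_0: "r \<notin> set w \<Longrightarrow> insertions r w 0 = {w}"
proof -
  assume r: "r \<notin> set w"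
  have "u = w" if "filter (\<lambda>a. a \<noteq> r) u = w" "length u = length w" for u
    using that by (metis filter_id_conv length_filter_less nat_neq_iff)
  moreover have "filter (\<lambda>a. a \<noteq> r) w = w" using r by (auto intro: filter_True)
  ultimately show ?thesis by (auto simp: insertions_def)
qed

lemma insertions_Nil_Suc: "insertions r [] (Suc t) = (#) r ` insertions r [] t"
proof (intro equalityI subsetI)
  fix u assume "u \<in> insertions r [] (Suc t)"
  then show "u \<in> (#) r ` insertions r [] t" by (cases u) (auto simp: insertions_def split: if_splits)
qed (auto simp: insertions_def)

lemma insertions_Cons_Suc:
  assumes "b \<noteq> r"
  shows "insertions r (b # w) (Suc t)
    = (#) b ` insertions r w (Suc t) \<union> (#) r ` insertions r (b # w) t"
proof (intro equalityI subsetI)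
  fix u assume "u \<in> insertions r (b # w) (Suc t)"
  then show "u \<in> (#) b ` insertions r w (Suc t) \<union> (#) r ` insertions r (b # w) t"
    by (cases u) (auto simp: insertions_def split: if_splits)
qed (use assms in \<open>auto simp: insertions_def\<close>)

lemma finite_insertions: "finite (insertions r w t)"
proof (rule finite_subset[OF _ finite_lists_length_eq[of "insert r (set w)" "length w + t"]])
  show "insertions r w t \<subseteq> {xs. set xs \<subseteq> insert r (set w) \<and> length xs = length w + t}"
    by (auto simp: insertions_def)
qed simp

lemma sum_Cons_insertions:
  fixes q :: "'a::comm_semiring_1"
  shows "(\<Sum>u\<in>(#) b ` insertions r w t. q ^ break_weight N (a # u))
    = q ^ (if b \<le> a \<and> b < N then Suc (length w + t) else 0)
      * (\<Sum>u\<in>insertions r w t. q ^ break_weight N (b # u))"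
proof -
  have "(\<Sum>u\<in>(#) b ` insertions r w t. q ^ break_weight N (a # u))
      = (\<Sum>u\<in>insertions r w t. q ^ break_weight N (a # b # u))"
    by (subst sum.reindex) auto
  also have "\<dots> = (\<Sum>u\<in>insertions r w t.
      q ^ (if b \<le> a \<and> b < N then Suc (length w + t) else 0) * q ^ break_weight N (b # u))"
  proof (rule sum.cong)
    fix u assume "u \<in> insertions r w t"
    then have len: "length u = length w + t" by (simp add: insertions_def)
    have "break_weight N (a # b # u)
        = (if b \<le> a \<and> b < N then Suc (length w + t) else 0) + break_weight N (b # u)"
      unfolding break_weight.simps(2)[of N a] using len by simp
    then show "q ^ break_weight N (a # b # u)
        = q ^ (if b \<le> a \<and> b < N then Suc (length w + t) else 0) * q ^ break_weight N (b # u)"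
      by (simp only: power_add)
  qed simp
  finally show ?thesis by (simp add: sum_distrib_left)
qed

text \<open>The insertion theorem: the distribution of the increment of the weight depends on \<open>w\<close> only
  through its length. The additional first letter \<open>a\<close> makes the induction possible,
  since the first letter of a word and its length determine the break created by a new letter in
  front. For the theorem \<open>a = N\<close> is needed, the other letters being cases of the induction: either
  the first letter of \<open>u\<close> is the one of \<open>w\<close>, or it is \<open>r\<close>, which then
  takes the role of \<open>a\<close>.\<close>
lemma sum_insertions:
  assumes "r < N" "\<forall>b\<in>set w. b < r \<or> b = N" "a \<le> N"
  shows "(\<Sum>u\<in>insertions r w t. q ^ break_weight N (a # u))
    = q ^ (break_weight N (a # w) + (if r \<le> a then t else 0)) * power_esym q (length w + t) t"
  using assms(2,3)
proof (induction "length w + t" arbitrary: w t a rule: less_induct)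
  case less
  show ?case
  proof (cases t)
    case 0
    have "r \<notin> set w" using less.prems assms(1) by auto
    then show ?thesis using 0 by (simp add: insertions_0)
  next
    case t: (Suc t')
    show ?thesis
    proof (cases w)
      case Nil
      have "power_esym q k (Suc k) = 0" for k
      proof -
        have "power_esym q k (k + Suc j) = 0" for j
          by (induction k arbitrary: j) (auto, metis add_Suc_right)
        from this[of 0] show ?thesis by simp
      qed
      moreover have "(\<Sum>u\<in>insertions r [] t'. q ^ break_weight N (r # u))
          = q ^ t' * power_esym q t' t'"
        using less.hyps[of "[]" t' r] assms(1) Nil t by simp
      ultimately show ?thesis
        using assms(1) unfolding Nil t insertions_Nil_Suc sum_Cons_insertions by simp
    next
      case w: (Cons b w')
      define h where "h = length w + t'"
      have b: "b \<noteq> r" "b < r \<or> b = N" using less.prems assms(1) w by auto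
      have "insertions r w t = (#) b ` insertions r w' t \<union> (#) r ` insertions r w t'"
        unfolding w t by (rule insertions_Cons_Suc[OF b(1)])
      then have "(\<Sum>u\<in>insertions r w t. q ^ break_weight N (a # u))
          = (\<Sum>u\<in>(#) b ` insertions r w' t. q ^ break_weight N (a # u))
            + (\<Sum>u\<in>(#) r ` insertions r w t'. q ^ break_weight N (a # u))"
        using b(1)
        by (simp add: finite_insertions, subst sum.union_disjoint) (auto simp: finite_insertions)
      also have "\<dots> = q ^ (if b \<le> a \<and> b < N then Suc h else 0)
            * (q ^ (break_weight N w + (if r \<le> b then t else 0)) * power_esym q h t)
          + q ^ (if r \<le> a then Suc h else 0)
            * (q ^ (break_weight N w + (if b < N then length w else 0) + t') * power_esym q h t')"
      proof -
        have 1: "(\<Sum>u\<in>insertions r w' t. q ^ break_weight N (b # u))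
            = q ^ (break_weight N w + (if r \<le> b then t else 0)) * power_esym q h t"
          using less.hyps[of w' t b] less.prems b assms(1) by (auto simp: w t h_def)
        have "break_weight N (r # w) = break_weight N w + (if b < N then length w else 0)"
          using b assms(1) unfolding break_weight.simps(2)[of N r w] by (auto simp: w)
        then have 2: "(\<Sum>u\<in>insertions r w t'. q ^ break_weight N (r # u))
            = q ^ (break_weight N w + (if b < N then length w else 0) + t') * power_esym q h t'"
          using less.hyps[of w t' r] less.prems(1) assms(1)
          by (auto simp: t h_def simp del: break_weight.simps)
        have len: "Suc (length w' + t) = Suc h" "Suc (length w + t') = Suc h"
          by (simp_all add: w t h_def)
        show ?thesis unfolding sum_Cons_insertions 1 2 len using assms(1) by simp
      qed
      also have "\<dots> = q ^ (break_weight N (a # w) + (if r \<le> a then t else 0)) * power_esym q (length w + t) t"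
      proof -
        have weight_aw: "break_weight N (a # w) = break_weight N w + (if b \<le> a \<and> b < N then length w else 0)"
          by (simp add: w)
        have len: "length w + t = Suc h" by (simp add: t h_def)
        have P1: "power_esym q (Suc h) t = power_esym q h t + q ^ h * power_esym q h t'" by (simp add: t)
        have P2: "power_esym q (Suc h) t = q ^ t * power_esym q h t + q ^ t' * power_esym q h t'"
          unfolding t by (rule power_esym_Suc_Suc_least)
        \<comment> \<open>If \<open>a < r\<close> and either \<open>b\<close> is the bar or there is a break before \<open>b\<close>, then a copy of \<open>r\<close>
          between \<open>a\<close> and \<open>b\<close> adds no break or takes over the existing one. This increment is the
          least possible, so the words that start with \<open>r\<close> belong to the products with the
          smallest exponent. In the other cases they belong to those with the largest one.\<close>
        consider "b = N" "a < r" | "b = N" "r \<le> a" | "b < r" "r \<le> a"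
          | "b < r" "a < r" "b \<le> a" | "b < r" "a < r" "a < b"
          using b by linarith
        then show ?thesis
        proof cases
          case 1 then show ?thesis unfolding weight_aw len P2 using assms(1)
            by (simp add: algebra_simps power_add)
        next
          case 2 then show ?thesis unfolding weight_aw len P1 using assms(1)
            by (simp add: algebra_simps power_add t)
        next
          case 3 then show ?thesis unfolding weight_aw len P1 using assms(1)
            by (simp add: algebra_simps power_add t h_def)
        next
          case 4 then show ?thesis unfolding weight_aw len P2 using assms(1)
            by (simp add: algebra_simps power_add t h_def)
        next
          case 5 then show ?thesis unfolding weight_aw len P1 using assms(1)
            by (simp add: algebra_simps power_add t h_def)
        qed
      qed
      finally show ?thesis .
    qed
  qed
qed

section \<open>Binary representations of colors\<close>

lemma mem_bin_powers: "2 ^ k \<in> bin_powers c \<longleftrightarrow> bit c k"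
  by (auto simp: bin_powers_def)

lemma bin_powers_exp: "bin_powers (2 ^ a) = {2 ^ a}"
  by (auto simp: bin_powers_def bit_exp_iff)

lemma bin_powers_set_bit: "bin_powers (set_bit a c) = insert (2 ^ a) (bin_powers c)"
  by (auto simp: bin_powers_def bit_set_bit_iff)

lemma less_exp_iff_bit: "(c::nat) < 2 ^ n \<longleftrightarrow> (\<forall>k. bit c k \<longrightarrow> k < n)"
proof
  assume "c < 2 ^ n" then show "\<forall>k. bit c k \<longrightarrow> k < n"
    by (metis bit_take_bit_iff take_bit_nat_eq_self_iff)
next
  assume "\<forall>k. bit c k \<longrightarrow> k < n"
  then have "take_bit n c = c" by (auto simp: bit_eq_iff bit_take_bit_iff)
  then show "c < 2 ^ n" using take_bit_nat_eq_self_iff by blast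
qed

lemma finite_bin_powers: "finite (bin_powers c)"
proof -
  have "{k. bit c k} \<subseteq> {..<c}"
    using less_exp_iff_bit[of c c] less_exp[of c] by blast
  then have "finite {k. bit c k}" using finite_subset by blast
  then show ?thesis unfolding bin_powers_def by (simp add: setcompr_eq_image)
qed

lemma bin_powers_nonempty:
  assumes "c > 0" shows "bin_powers c \<noteq> {}"
proof
  assume "bin_powers c = {}"
  then have "\<not> bit c k" for k using mem_bin_powers by blast
  then have "c = 0" by (intro bit_eqI) simp
  then show False using assms by simp
qed

lemma \<omega>_exp: "\<omega> (2 ^ a) = 1" by (simp add: \<omega>_def bin_powers_exp)
lemma v_exp: "v (2 ^ a) = 2 ^ a" by (simp add: v_def bin_powers_exp)
lemma z_exp: "z (2 ^ a) = 2 ^ a" by (simp add: z_def bin_powers_exp)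

lemma
  assumes "c > 0" "2 ^ a < v c"
  shows \<omega>_set_bit: "\<omega> (set_bit a c) = Suc (\<omega> c)"
    and v_set_bit: "v (set_bit a c) = 2 ^ a"
    and z_set_bit: "z (set_bit a c) = z c"
proof -
  note fin = finite_bin_powers[of c] bin_powers_nonempty[OF assms(1)]
  have low: "2 ^ a < p" if "p \<in> bin_powers c" for p
    using that assms(2) fin unfolding v_def by (simp add: Min_gr_iff)
  show "\<omega> (set_bit a c) = Suc (\<omega> c)"
    unfolding \<omega>_def bin_powers_set_bit using low fin by (metis card_insert_disjoint less_irrefl)
  show "v (set_bit a c) = 2 ^ a"
    unfolding v_def bin_powers_set_bit using low fin by (intro Min_eqI) (auto intro: less_imp_le)
  show "z (set_bit a c) = z c"
    unfolding z_def bin_powers_set_bit using fin low[OF Max_in[OF fin]] by (simp add: max_def)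
qed

lemma v_le_bit: "bit c k \<Longrightarrow> v c \<le> 2 ^ k"
  unfolding v_def using finite_bin_powers mem_bin_powers by (intro Min_le) auto

lemma v_obtains:
  assumes "c > 0" obtains a where "bit c a" "v c = 2 ^ a"
proof -
  have "v c \<in> bin_powers c" unfolding v_def
    using finite_bin_powers bin_powers_nonempty assms Min_in by blast
  then show thesis using that by (auto simp: bin_powers_def)
qed

text \<open>Colors are built from the top bit downwards, in the order in which a run grows when letters
  are put in front of a word.\<close>
lemma color_cases:
  assumes "c > 0"
  obtains a where "c = 2 ^ a"
  | a c' where "c = set_bit a c'" "c' > 0" "2 ^ a < v c'"
proof -
  obtain a where a: "bit c a" "v c = 2 ^ a" using v_obtains[OF assms] .
  define c' where "c' = unset_bit a c"
  have c: "c = set_bit a c'"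
    unfolding c'_def by (rule bit_eqI) (use a(1) in \<open>auto simp: bit_set_bit_iff bit_unset_bit_iff\<close>)
  show thesis
  proof (cases "c' = 0")
    case True
    then have "c = 2 ^ a" using c by (simp add: set_bit_eq_or)
    then show thesis using that by blast
  next
    case False
    then obtain b where b: "bit c' b" "v c' = 2 ^ b" using v_obtains by blast
    then have "bit c b" "b \<noteq> a" by (auto simp: c'_def bit_unset_bit_iff)
    then have "(2::nat) ^ a < 2 ^ b" using v_le_bit[of c b] a(2) b
      by (metis le_neq_implies_less power_inject_exp one_less_numeral_iff semiring_norm(76))
    then show thesis using that(2)[OF c] False b by simp
  qed
qed

lemma \<omega>_pos: "c > 0 \<Longrightarrow> \<omega> c > 0"
  unfolding \<omega>_def using finite_bin_powers bin_powers_nonempty card_gt_0_iff by blast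

lemma \<omega>\<^sub>e_le: "\<omega>\<^sub>e c \<le> \<omega> c"
  unfolding \<omega>_def \<omega>\<^sub>e_def by (intro card_mono finite_bin_powers) auto

lemma \<omega>\<^sub>e_exp: "\<omega>\<^sub>e (2 ^ a) = (if a = 0 then 0 else 1)"
proof -
  have "{p \<in> bin_powers (2 ^ a). even p} = (if a = 0 then {} else {2 ^ a})"
    by (auto simp: bin_powers_exp)
  then show ?thesis by (simp add: \<omega>\<^sub>e_def)
qed

lemma \<omega>\<^sub>e_set_bit:
  assumes "\<not> bit c a"
  shows "\<omega>\<^sub>e (set_bit a c) = (if a = 0 then 0 else 1) + \<omega>\<^sub>e c"
proof -
  have "{p \<in> bin_powers (set_bit a c). even p}
      = (if a = 0 then {} else {2 ^ a}) \<union> {p \<in> bin_powers c. even p}"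
    by (auto simp: bin_powers_set_bit)
  moreover have "2 ^ a \<notin> {p \<in> bin_powers c. even p}" using assms by (simp add: mem_bin_powers)
  ultimately show ?thesis unfolding \<omega>\<^sub>e_def using finite_bin_powers
    by (cases "a = 0") (simp_all add: card_insert_if)
qed

lemma odd_set_bit: "odd (set_bit a c :: nat) \<longleftrightarrow> a = 0 \<or> odd c"
  using bit_set_bit_iff[of a c 0] by (auto simp: bit_0)

lemma set_bit_pos: "0 < (set_bit a c :: nat)"
  using bit_set_bit_iff[of a c a] by (intro gr0I) simp

section \<open>Words and colored partitions\<close>

text \<open>The conditions that define the partitions counted by \<open>B\<close>, apart from the prescribed sum and
  numbers of colors, in a form that only compares a part with its successor. The decreasing order
  of the parts follows, since \<open>\<omega>\<close> is positive on positive colors.\<close>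
fun well_spaced :: "nat \<Rightarrow> colored_part list \<Rightarrow> bool" where
  "well_spaced n [] = True"
| "well_spaced n ((s, c) # L) \<longleftrightarrow> 0 < c \<and> c < 2 ^ n \<and>
     \<omega> c + (case L of [] \<Rightarrow> 0 | p # _ \<Rightarrow> part_size p + \<delta> c (part_color p)) \<le> s \<and> well_spaced n L"

text \<open>The colored partition of a word, read from the right: a letter below the bar either joins
  the run that follows it, if it is smaller than the first letter of that run, or forms a
  run of its own. The inner case of the empty list never matters, since a word that starts
  with a letter below \<open>N\<close> has a run.\<close>
fun runs :: "nat \<Rightarrow> nat list \<Rightarrow> colored_part list" where
  "runs N [] = []"
| "runs N (a # w) =
    (if N \<le> a then runs N w
     else if w \<noteq> [] \<and> a < hd w \<and> hd w < N
       then (case runs N w of [] \<Rightarrow> [] | (s, c) # L \<Rightarrow> (Suc s, set_bit a c) # L)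
     else (Suc (length w), 2 ^ a) # runs N w)"

text \<open>Only if \<open>w\<close> starts with a letter below the bar does a part of maximal possible size \<open>length w\<close>
  occur, and then its color reveals that letter. The reconstruction of the word
  from its runs rests on this.\<close>
lemma runs_hd_letter:
  "w \<noteq> [] \<Longrightarrow> hd w < N \<Longrightarrow>
    \<exists>c L. runs N w = (length w, c) # L \<and> 0 < c \<and> v c = 2 ^ hd w"
proof (induction w)
  case (Cons a w)
  show ?case
  proof (cases "w \<noteq> [] \<and> a < hd w \<and> hd w < N")
    case True
    then obtain c L where "runs N w = (length w, c) # L" "0 < c" "v c = 2 ^ hd w"
      using Cons.IH by blast
    moreover then have "v (set_bit a c) = 2 ^ a" using True by (intro v_set_bit) auto
    ultimately show ?thesis using Cons.prems True
      by (auto simp: set_bit_pos)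
  qed (use Cons.prems in \<open>auto simp: v_exp\<close>)
qed simp

lemma runs_size_le: "p \<in> set (runs N w) \<Longrightarrow> part_size p \<le> length w"
proof (induction w arbitrary: p)
  case (Cons a w)
  have "p \<in> set (runs N w) \<or> part_size p = Suc (length w)
      \<or> (\<exists>s c L. runs N w = (s, c) # L \<and> part_size p = Suc s)"
    using Cons.prems by (cases "runs N w") (auto split: if_splits prod.splits)
  then show ?case
  proof (elim disjE exE conjE)
    fix s c L assume "runs N w = (s, c) # L" "part_size p = Suc s"
    then show ?thesis using Cons.IH[of "(s, c)"] by simp
  qed (use Cons.IH[of p] in auto)
qed simp

lemma runs_length_cases:
  obtains "w \<noteq> []" "hd w < N"
  | "\<And>p. p \<in> set (runs N w) \<Longrightarrow> part_size p < length w"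
proof (cases w)
  case (Cons a w')
  show thesis
  proof (cases "a < N")
    case False
    have "part_size p < length w" if "p \<in> set (runs N w)" for p
      using that runs_size_le[of p N w'] False Cons by auto
    then show thesis using that by blast
  next
    case True
    show thesis by (rule that(1)) (use True Cons in simp_all)
  qed
next
  case Nil
  show thesis by (rule that(2)) (simp add: Nil)
qed

lemma runs_Cons_cases [case_names bar extend new]:
  obtains "N \<le> a" "runs N (a # w) = runs N w"
  | c L where "a < N" "w \<noteq> []" "a < hd w" "hd w < N" "runs N w = (length w, c) # L" "0 < c"
      "v c = 2 ^ hd w" "\<not> bit c a" "runs N (a # w) = (Suc (length w), set_bit a c) # L"
  | "a < N" "w = [] \<or> hd w \<le> a \<or> N \<le> hd w" "runs N (a # w) = (Suc (length w), 2 ^ a) # runs N w"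
proof (cases "a < N \<and> w \<noteq> [] \<and> a < hd w \<and> hd w < N")
  case True
  then obtain c L where c: "runs N w = (length w, c) # L" "0 < c" "v c = 2 ^ hd w"
    using runs_hd_letter by blast
  moreover have "\<not> bit c a"
    using v_le_bit[of c a] c(3) True by auto
  ultimately show thesis using that(2)[of c L] True by auto
next
  case False
  then consider "N \<le> a" | "a < N" "w = [] \<or> hd w \<le> a \<or> N \<le> hd w" by linarith
  then show thesis
  proof cases
    case 1
    show thesis by (rule that(1)) (use 1 in simp_all)
  next
    case 2
    show thesis by (rule that(3)) (use 2 in auto)
  qed
qed

text \<open>For a letter that forms a new run in front of another run, the gap is \<open>1\<close> if the
  next letter is below the bar; this suffices, because then the next letter is at most \<open>a\<close> and \<open>\<delta>\<close>
  vanishes. If the next letter is a bar, the gap is at least \<open>2\<close>.\<close>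
lemma well_spaced_runs:
  assumes "n \<le> N"
  shows "set w \<subseteq> {..<n} \<union> {N} \<Longrightarrow> well_spaced n (runs N w)"
proof (induction w)
  case (Cons a w)
  then have IH: "well_spaced n (runs N w)" by simp
  show ?case
  proof (cases rule: runs_Cons_cases[of N a w])
    case bar
    then show ?thesis using IH by simp
  next
    case (extend c L)
    have lt: "2 ^ a < v c" using extend by simp
    have "set_bit a c < 2 ^ n"
      using IH extend Cons.prems assms unfolding less_exp_iff_bit extend(5)
      by (auto simp: bit_set_bit_iff less_exp_iff_bit)
    moreover have "0 < set_bit a c" by (rule set_bit_pos)
    ultimately show ?thesis
      using IH lt extend
      by (auto simp: \<omega>_set_bit z_set_bit \<delta>_def split: list.splits)
  next
    case new
    have "a < n" using Cons.prems new(1) by auto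
    then have "(2::nat) ^ a < 2 ^ n" by simp
    moreover have "part_size p + \<delta> (2 ^ a) (part_color p) \<le> length w"
      if "runs N w = p # L" for p L
    proof (cases rule: runs_length_cases[of w N])
      case 1
      then obtain c where "p = (length w, c)" "v c = 2 ^ hd w"
        using runs_hd_letter[of w N] \<open>runs N w = p # L\<close> by auto
      then show ?thesis using 1 new(2) by (auto simp: \<delta>_def z_exp)
    next
      case 2
      then have "part_size p < length w" using that by simp
      then show ?thesis by (simp add: \<delta>_def)
    qed
    ultimately show ?thesis using new(3) IH by (auto simp: \<omega>_exp split: list.splits)
  qed
qed simp

text \<open>Equal length has to be assumed, as leading bars do not show in the runs.\<close>
lemma runs_inject:
  assumes "length u = length w" "set u \<subseteq> {..N}" "set w \<subseteq> {..N}" "runs N u = runs N w"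
  shows "u = w"
  using assms
proof (induction u w rule: list_induct2)
  case (Cons a u b w)
  have long: "part_size (hd (runs N (c # y))) = Suc (length y)" "v (part_color (hd (runs N (c # y)))) = 2 ^ c"
       "runs N (c # y) \<noteq> []"
    if "c < N" for c y using runs_hd_letter[of "c # y" N] that by auto
  have short: "part_size p \<le> length y" if "N \<le> c" "p \<in> set (runs N (c # y))" for c y p
    using runs_size_le[of p N y] that by simp
  have ab: "a = b"
  proof (cases "a < N \<or> b < N")
    case True
    have "a < N \<and> b < N"
    proof (rule ccontr)
      assume "\<not> (a < N \<and> b < N)"
      then show False using True long[of a u] long[of b w] short[of a "hd (runs N (a # u))" u]
         short[of b "hd (runs N (b # w))" w] Cons.prems(3) Cons.hyps
         by (metis Suc_n_not_le_n hd_in_set leI)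
    qed
    then have "(2::nat) ^ a = 2 ^ b" using long(2) Cons.prems(3) by metis
    then show ?thesis by simp
  qed (use Cons.prems in auto)
  have "runs N u = runs N w"
  proof (cases rule: runs_Cons_cases[of N a u])
    case bar
    then show ?thesis using Cons.prems(3) ab by simp
  next
    case u: (extend c L)
    show ?thesis
    proof (cases rule: runs_Cons_cases[of N b w])
      case bar then show ?thesis using ab u by simp
    next
      case w: (extend c' L')
      have "set_bit a c = set_bit a c'" "L = L'" using u w ab Cons.prems(3) by auto
      moreover have "c = c'"
      proof (rule bit_eqI)
        fix k show "bit c k = bit c' k"
          using \<open>set_bit a c = set_bit a c'\<close> u(8) w(8) ab
          by (metis bit_set_bit_iff possible_bit_nat)
      qed
      ultimately show ?thesis using u w Cons.hyps by simp
    next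
      case new
      then have eq: "set_bit a c = 2 ^ a" using u ab Cons.prems(3) by simp
      have "\<omega> (set_bit a c) = Suc (\<omega> c)" using u by (intro \<omega>_set_bit) auto
      then show ?thesis using \<omega>_pos[OF u(6)] unfolding eq \<omega>_exp by simp
    qed
  next
    case u: new
    show ?thesis
    proof (cases rule: runs_Cons_cases[of N b w])
      case bar then show ?thesis using ab u by simp
    next
      case w: (extend c L)
      then have eq: "set_bit b c = 2 ^ b" using u ab Cons.prems(3) by simp
      have "\<omega> (set_bit b c) = Suc (\<omega> c)" using w by (intro \<omega>_set_bit) auto
      then show ?thesis using \<omega>_pos[OF w(6)] unfolding eq \<omega>_exp by simp
    next
      case new then show ?thesis using u Cons.prems(3) by simp
    qed
  qed
  then show ?case using Cons ab by simp
qed simp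

text \<open>The word is built from its last letter to its first one, \<open>l\<close> being the number of letters still
  to be written: a bar unless the first part has size \<open>l\<close>. Otherwise the lowest bit of its
  color is written, and the rest of the color, if any, remains as the color of a part of size \<open>l - 1\<close>.\<close>
lemma runs_surj:
  assumes "n \<le> N"
  shows "well_spaced n L \<Longrightarrow> (L \<noteq> [] \<longrightarrow> part_size (hd L) \<le> l)
    \<Longrightarrow> \<exists>w. length w = l \<and> set w \<subseteq> {..<n} \<union> {N} \<and> runs N w = L"
proof (induction l arbitrary: L)
  case 0
  have "L = []"
  proof (cases L)
    case (Cons p L')
    obtain s c where "p = (s, c)" by (cases p)
    then show ?thesis using 0 Cons \<omega>_pos[of c] by auto
  qed simp
  then show ?case by simp
next
  case (Suc l)
  show ?case
  proof (cases "L \<noteq> [] \<and> part_size (hd L) = Suc l")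
    case False
    then have "L \<noteq> [] \<longrightarrow> part_size (hd L) \<le> l" using Suc.prems(2) by auto
    then obtain w where "length w = l" "set w \<subseteq> {..<n} \<union> {N}" "runs N w = L"
      using Suc.IH Suc.prems(1) by blast
    then show ?thesis by (intro exI[of _ "N # w"]) auto
  next
    case True
    then obtain c L' where L: "L = (Suc l, c) # L'" by (cases L) auto
    have c: "0 < c" "c < 2 ^ n" and tail: "well_spaced n L'"
      and gap: "\<omega> c + (case L' of [] \<Rightarrow> 0 | p # _ \<Rightarrow> part_size p + \<delta> c (part_color p)) \<le> Suc l"
      using Suc.prems(1) unfolding L by auto
    from c(1) show ?thesis
    proof (cases rule: color_cases)
      case (1 a)
      have "a < n" using c(2) 1 by simp
      have "L' \<noteq> [] \<longrightarrow> part_size (hd L') \<le> l"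
        using gap unfolding 1 \<omega>_exp by (cases L') auto
      then obtain w where w: "length w = l" "set w \<subseteq> {..<n} \<union> {N}" "runs N w = L'"
        using Suc.IH tail by blast
      have "runs N (a # w) = L"
      proof (cases rule: runs_Cons_cases[of N a w])
        case (extend c' L'')
        \<comment> \<open>The letter may not merge with the run after it: \<open>\<delta>\<close> would force a larger gap.\<close>
        then have "z c < v c'" using 1 by (simp add: z_exp)
        then have False using gap extend w unfolding 1 \<omega>_exp by (auto simp: \<delta>_def)
        then show ?thesis ..
      qed (use w L 1 \<open>a < n\<close> assms in auto)
      then show ?thesis using w \<open>a < n\<close> by (intro exI[of _ "a # w"]) auto
    next
      case (2 a c')
      have "bit c a" using 2(1) by (simp add: bit_set_bit_iff)
      then have "a < n" using c(2) less_exp_iff_bit by blast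
      have "c' < 2 ^ n" using c(2) unfolding 2(1) less_exp_iff_bit by (auto simp: bit_set_bit_iff)
      then have "well_spaced n ((l, c') # L')"
        using 2 tail gap by (auto simp: \<omega>_set_bit z_set_bit \<delta>_def split: list.splits)
      then obtain w where w: "length w = l" "set w \<subseteq> {..<n} \<union> {N}" "runs N w = (l, c') # L'"
        using Suc.IH by fastforce
      have "w \<noteq> [] \<and> hd w < N"
      proof (cases rule: runs_length_cases[of w N])
        case 2
        then show ?thesis using 2[of "(l, c')"] w by simp
      qed simp
      moreover then have "2 ^ hd w = v c'" using runs_hd_letter[of w N] w by auto
      then have "a < hd w" using 2(3) by (metis nat_power_less_imp_less pos2)
      ultimately have "runs N (a # w) = L" using w L 2 \<open>a < n\<close> assms by auto
      then show ?thesis using w \<open>a < n\<close> by (intro exI[of _ "a # w"]) auto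
    qed
  qed
qed

text \<open>A part of the partition is the number of letters to the right of a break; the bar in front
  of the word turns the start of the first run into a break.\<close>
lemma sum_list_runs:
  "set w \<subseteq> {..N} \<Longrightarrow> sum_list (map part_size (runs N w)) = break_weight N (N # w)"
proof (induction w)
  case (Cons a w)
  show ?case
    by (cases rule: runs_Cons_cases[of N a w]) (use Cons in auto)
qed simp

lemma count_runs:
  "k < N \<Longrightarrow> length (filter (\<lambda>p. bit (part_color p) k) (runs N w)) = count_list w k"
proof (induction w)
  case (Cons a w)
  show ?case
    by (cases rule: runs_Cons_cases[of N a w])
      (use Cons in \<open>auto simp: bit_set_bit_iff bit_exp_iff\<close>)
qed simp

section \<open>Differences between parts with odd color\<close>

abbreviation zero_bar_count :: "nat \<Rightarrow> nat list \<Rightarrow> nat" where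
  "zero_bar_count N w \<equiv> length (filter (\<lambda>b. b = 0 \<or> b = N) w)"

text \<open>The lengths of the suffixes that start with a \<open>0\<close>, measured in the subword of zeros and bars.\<close>
fun zero_parts :: "nat \<Rightarrow> nat list \<Rightarrow> nat list" where
  "zero_parts N [] = []"
| "zero_parts N (a # w) = (if a = 0 then [Suc (zero_bar_count N w)] else []) @ zero_parts N w"

abbreviation sum_\<omega>\<^sub>e :: "colored_part list \<Rightarrow> nat" where
  "sum_\<omega>\<^sub>e L \<equiv> sum_list (map (\<lambda>p. \<omega>\<^sub>e (part_color p)) L)"

text \<open>Every odd-colored part is reduced by the values of \<open>\<omega>\<^sub>e\<close> on its own color and on the colors of
  all smaller parts. The differences of the reduced parts decide the condition involving \<open>M\<close>.\<close>
fun odd_parts :: "colored_part list \<Rightarrow> nat list" where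
  "odd_parts [] = []"
| "odd_parts (p # L) =
    (if odd (part_color p) then [part_size p - sum_\<omega>\<^sub>e (p # L)] else []) @ odd_parts L"

lemma zero_parts_filter:
  assumes "r \<noteq> 0" "r \<noteq> N"
  shows "zero_parts N (filter (\<lambda>a. a \<noteq> r) w) = zero_parts N w"
proof (induction w)
  case (Cons a w)
  have "filter (\<lambda>b. b \<noteq> r \<and> (b = 0 \<or> b = N)) w = filter (\<lambda>b. b = 0 \<or> b = N) w"
    using assms by (intro filter_cong) auto
  then show ?case using Cons assms by (simp add: conj_commute)
qed simp

lemma sum_\<omega>\<^sub>e_runs:
  "set w \<subseteq> {..N} \<Longrightarrow> sum_\<omega>\<^sub>e (runs N w) + zero_bar_count N w = length w"
proof (induction w)
  case (Cons a w)
  show ?case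
    by (cases rule: runs_Cons_cases[of N a w])
      (use Cons in \<open>auto simp: \<omega>\<^sub>e_exp \<omega>\<^sub>e_set_bit\<close>)
qed simp

text \<open>A part with odd color starts at a \<open>0\<close>, since a \<open>0\<close> always starts a run. The values of \<open>\<omega>\<^sub>e\<close> that
  are subtracted count the letters of its suffix that are neither \<open>0\<close> nor a bar.\<close>
lemma odd_parts_runs:
  assumes "0 < N"
  shows "set w \<subseteq> {..N} \<Longrightarrow> odd_parts (runs N w) = zero_parts N w"
proof (induction w)
  case (Cons a w)
  then have IH: "odd_parts (runs N w) = zero_parts N w" by simp
  have sum: "sum_\<omega>\<^sub>e (runs N w) + zero_bar_count N w = length w"
    using sum_\<omega>\<^sub>e_runs Cons.prems by simp
  show ?case
  proof (cases rule: runs_Cons_cases[of N a w])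
    case bar
    then show ?thesis using IH assms by simp
  next
    case (extend c L)
    have "(2::nat) ^ 0 < 2 ^ hd w" using extend(3) by (intro power_strict_increasing) auto
    then have "\<not> bit c 0" using v_le_bit[of c 0] unfolding extend(7) by (meson leD)
    then have "even c" by (simp add: bit_0)
    then show ?thesis using IH sum extend
      by (auto simp: odd_set_bit \<omega>\<^sub>e_set_bit)
  next
    case new
    then show ?thesis using IH sum \<omega>\<^sub>e_exp[of a] by auto
  qed
qed simp

lemma all_nat_iff: "(\<forall>i::nat. P i) \<longleftrightarrow> P 0 \<and> (\<forall>i. P (Suc i))"
  by (metis not0_implies_Suc)

lemma well_spaced_iff:
  "well_spaced n L \<longleftrightarrow> (\<forall>p\<in>set L. 0 < part_color p \<and> part_color p < 2 ^ n)
    \<and> (L \<noteq> [] \<longrightarrow> \<omega> (part_color (last L)) \<le> part_size (last L))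
    \<and> (\<forall>i. i + 1 < length L \<longrightarrow>
          part_size (L ! i) \<ge> part_size (L ! (i + 1)) + \<omega> (part_color (L ! i))
            + \<delta> (part_color (L ! i)) (part_color (L ! (i + 1))))"
proof (induction n L rule: well_spaced.induct)
  case (2 n s c L)
  show ?case
  proof (cases L)
    case (Cons q L')
    show ?thesis
      by (subst all_nat_iff) (use 2 Cons in \<open>auto simp: add_ac\<close>)
  qed simp
qed simp

lemma well_spaced_sorted: "well_spaced n L \<Longrightarrow> sorted_wrt (\<lambda>p q. part_size p > part_size q) L"
proof (induction n L rule: well_spaced.induct)
  case (2 n s c L)
  then have IH: "sorted_wrt (\<lambda>p q. part_size p > part_size q) L" by simp
  have "\<omega> c > 0" using 2 \<omega>_pos by simp
  then show ?case using 2 IH by (cases L) auto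
qed simp

lemma well_spaced_size_pos: "well_spaced n L \<Longrightarrow> p \<in> set L \<Longrightarrow> 0 < part_size p"
proof (induction n L rule: well_spaced.induct)
  case (2 n s c L)
  have "\<omega> c > 0" using 2 \<omega>_pos by simp
  then show ?case using 2 by auto
qed simp

lemma well_spaced_sum_\<omega>\<^sub>e_le: "well_spaced n (p # L) \<Longrightarrow> sum_\<omega>\<^sub>e (p # L) \<le> part_size p"
proof (induction L arbitrary: p)
  case Nil
  then show ?case using \<omega>\<^sub>e_le[of "part_color p"] by (cases p) auto
next
  case (Cons q L)
  have "sum_\<omega>\<^sub>e (q # L) \<le> part_size q" using Cons by (cases p) auto
  then show ?case using Cons.prems \<omega>\<^sub>e_le[of "part_color p"] by (cases p) auto
qed

lemma well_spaced_drop: "well_spaced n L \<Longrightarrow> well_spaced n (drop j L)"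
proof (induction L arbitrary: j)
  case (Cons p L)
  then show ?case by (cases j; cases p) auto
qed simp

lemma set_odd_parts:
  "set (odd_parts L) =
    {part_size (L ! j) - sum_\<omega>\<^sub>e (drop j L) | j. j < length L \<and> odd (part_color (L ! j))}"
proof (induction L)
  case (Cons p L)
  have "{part_size ((p # L) ! j) - sum_\<omega>\<^sub>e (drop j (p # L))
          | j. j < length (p # L) \<and> odd (part_color ((p # L) ! j))}
      = (if odd (part_color p) then {part_size p - sum_\<omega>\<^sub>e (p # L)} else {})
        \<union> {part_size (L ! j) - sum_\<omega>\<^sub>e (drop j L) | j. j < length L \<and> odd (part_color (L ! j))}"
    (is "?l = ?r")
  proof (intro equalityI subsetI)
    fix y assume "y \<in> ?l"
    then obtain j where "y = part_size ((p # L) ! j) - sum_\<omega>\<^sub>e (drop j (p # L))"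
      "j < length (p # L)" "odd (part_color ((p # L) ! j))" by blast
    then show "y \<in> ?r" by (cases j) auto
  next
    fix y assume "y \<in> ?r"
    then consider "odd (part_color p)" "y = part_size p - sum_\<omega>\<^sub>e (p # L)"
      | j where "y = part_size (L ! j) - sum_\<omega>\<^sub>e (drop j L)" "j < length L" "odd (part_color (L ! j))"
      by (auto split: if_splits)
    then show "y \<in> ?l"
    proof cases
      case 1 then show ?thesis by (intro CollectI exI[of _ 0]) simp
    next
      case (2 j) then show ?thesis by (intro CollectI exI[of _ "Suc j"]) simp
    qed
  qed
  then show ?case using Cons by simp
qed simp

lemma sum_\<omega>\<^sub>e_split:
  "j \<le> length L \<Longrightarrow> (\<Sum>l<j. \<omega>\<^sub>e (part_color (L ! l))) + sum_\<omega>\<^sub>e (drop j L) = sum_\<omega>\<^sub>e L"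
proof (induction L arbitrary: j)
  case (Cons p L)
  then show ?case by (cases j) (simp_all add: sum.lessThan_Suc_shift del: sum.lessThan_Suc)
qed simp

lemma parts_differ_by_Cons:
  "parts_differ_by M (a # \<mu>) \<longleftrightarrow> (\<forall>b\<in>set \<mu>. b + M \<le> a) \<and> parts_differ_by M \<mu>"
proof -
  have "parts_differ_by M \<mu> \<longleftrightarrow> sorted_wrt (\<lambda>a b. b + M \<le> a) \<mu>" for \<mu>
    by (auto simp: parts_differ_by_def sorted_wrt_iff_nth_less)
  then show ?thesis by simp
qed

lemma all_pairs_less_Suc:
  "(\<forall>i j. i < j \<and> j < Suc k \<longrightarrow> Q i j) \<longleftrightarrow>
    (\<forall>j<k. Q 0 (Suc j)) \<and> (\<forall>i j. i < j \<and> j < k \<longrightarrow> Q (Suc i) (Suc j))"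
  (is "?l \<longleftrightarrow> ?r")
proof
  assume r: ?r
  show ?l
  proof (intro allI impI)
    fix i j assume "i < j \<and> j < Suc k"
    then show "Q i j" using r by (cases i; cases j) auto
  qed
qed simp

text \<open>The sum of \<open>\<omega>\<^sub>e\<close> from \<open>i\<close> to \<open>j - 1\<close> is the difference of the amounts subtracted from the parts
  \<open>i\<close> and \<open>j\<close>. The truncated subtraction is harmless because these amounts do not exceed the
  parts.\<close>
lemma odd_gaps_iff:
  "well_spaced n L \<Longrightarrow> parts_differ_by M (odd_parts L) \<longleftrightarrow>
    (\<forall>i j. i < j \<and> j < length L \<longrightarrow> odd (part_color (L ! i)) \<and> odd (part_color (L ! j)) \<longrightarrow>
       part_size (L ! j) + M + (\<Sum>l = i..<j. \<omega>\<^sub>e (part_color (L ! l))) \<le> part_size (L ! i))"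
proof (induction L)
  case Nil
  then show ?case by (simp add: parts_differ_by_def)
next
  case (Cons p L)
  have "well_spaced n L" using Cons.prems by (cases p) simp
  note IH = Cons.IH[OF this]
  have head: "part_size (L ! j) - sum_\<omega>\<^sub>e (drop j L) + M \<le> part_size p - sum_\<omega>\<^sub>e (p # L)
      \<longleftrightarrow> part_size (L ! j) + M + (\<Sum>l = 0..<Suc j. \<omega>\<^sub>e (part_color ((p # L) ! l))) \<le> part_size p"
    if j: "j < length L" for j
  proof -
    have "sum_\<omega>\<^sub>e (p # L) \<le> part_size p" using well_spaced_sum_\<omega>\<^sub>e_le[OF Cons.prems] .
    moreover have "sum_\<omega>\<^sub>e (drop j L) \<le> part_size (L ! j)"
      using well_spaced_sum_\<omega>\<^sub>e_le well_spaced_drop[OF \<open>well_spaced n L\<close>, of j] j by (metis Cons_nth_drop_Suc)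
    moreover have "(\<Sum>l = 0..<Suc j. \<omega>\<^sub>e (part_color ((p # L) ! l)))
        = \<omega>\<^sub>e (part_color p) + (\<Sum>l<j. \<omega>\<^sub>e (part_color (L ! l)))"
      by (simp add: atLeast0LessThan sum.lessThan_Suc_shift del: sum.lessThan_Suc)
    moreover have "sum_\<omega>\<^sub>e (p # L) = \<omega>\<^sub>e (part_color p) + sum_\<omega>\<^sub>e L" by simp
    moreover have "(\<Sum>l<j. \<omega>\<^sub>e (part_color (L ! l))) + sum_\<omega>\<^sub>e (drop j L) = sum_\<omega>\<^sub>e L"
      using sum_\<omega>\<^sub>e_split j by simp
    ultimately show ?thesis by linarith
  qed
  have shift: "(\<Sum>l = Suc i..<Suc j. \<omega>\<^sub>e (part_color ((p # L) ! l)))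
      = (\<Sum>l = i..<j. \<omega>\<^sub>e (part_color (L ! l)))" for i j
    by (simp only: sum.shift_bounds_Suc_ivl nth_Cons_Suc)
  have "parts_differ_by M (odd_parts (p # L)) \<longleftrightarrow>
      (odd (part_color p) \<longrightarrow> (\<forall>b\<in>set (odd_parts L). b + M \<le> part_size p - sum_\<omega>\<^sub>e (p # L)))
      \<and> parts_differ_by M (odd_parts L)"
    by (simp add: parts_differ_by_Cons)
  also have "(\<forall>b\<in>set (odd_parts L). b + M \<le> part_size p - sum_\<omega>\<^sub>e (p # L)) \<longleftrightarrow>
      (\<forall>j. j < length L \<and> odd (part_color (L ! j)) \<longrightarrow>
        part_size (L ! j) + M + (\<Sum>l = 0..<Suc j. \<omega>\<^sub>e (part_color ((p # L) ! l))) \<le> part_size p)"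
    unfolding set_odd_parts using head by blast
  finally show ?case
    unfolding IH length_Cons all_pairs_less_Suc shift nth_Cons_0 nth_Cons_Suc by blast
qed

lemma BM_set_iff:
  "L \<in> BM_set n M x m \<longleftrightarrow> well_spaced n L \<and> sum_list (map part_size L) = m
    \<and> (\<forall>k<n. length (filter (\<lambda>p. bit (part_color p) k) L) = x (Suc k))
    \<and> parts_differ_by M (odd_parts L)"
proof -
  have colors: "(\<forall>r\<in>{1..n}. card {i. i < length L \<and> 2 ^ (r - 1) \<in> bin_powers (part_color (L ! i))} = x r)
    \<longleftrightarrow> (\<forall>k<n. length (filter (\<lambda>p. bit (part_color p) k) L) = x (Suc k))" (is "?l \<longleftrightarrow> ?r")
  proof
    assume l: ?l
    show ?r
    proof (intro allI impI)
      fix k assume "k < n"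
      then have "Suc k \<in> {1..n}" by simp
      from bspec[OF l this]
      show "length (filter (\<lambda>p. bit (part_color p) k) L) = x (Suc k)"
        by (simp add: mem_bin_powers length_filter_conv_card)
    qed
  next
    assume r: ?r
    show ?l
    proof
      fix k assume "k \<in> {1..n}"
      then obtain k' where "k = Suc k'" "k' < n" by (cases k) auto
      then show "card {i. i < length L \<and> 2 ^ (k - 1) \<in> bin_powers (part_color (L ! i))} = x k"
        using r by (simp add: mem_bin_powers length_filter_conv_card)
    qed
  qed
  have sorted: "is_colored_partition (2 ^ n - 1) L \<and> distinct L" if L: "well_spaced n L"
  proof -
    have "sorted_wrt colored_ge L"
      using well_spaced_sorted[OF L] by (rule sorted_wrt_mono_rel[rotated]) (simp add: colored_ge_def)
    moreover have "distinct L"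
      using well_spaced_sorted[OF L] unfolding sorted_wrt_iff_nth_less distinct_conv_nth
      by (metis linorder_neqE_nat less_irrefl)
    moreover have "part_color p \<in> {1..2 ^ n - 1}" if "p \<in> set L" for p
    proof -
      have "0 < part_color p" "part_color p < 2 ^ n" using that L unfolding well_spaced_iff by blast+
      then show ?thesis by simp
    qed
    ultimately show ?thesis using well_spaced_size_pos[OF L] by (auto simp: is_colored_partition_def)
  qed
  have "(\<forall>p\<in>set L. 0 < part_color p \<and> part_color p < 2 ^ n)"
    if "is_colored_partition (2 ^ n - 1) L"
    using that by (fastforce simp: is_colored_partition_def)
  then have B: "L \<in> B_set n x m \<longleftrightarrow> well_spaced n L \<and> sum_list (map part_size L) = m
    \<and> (\<forall>k<n. length (filter (\<lambda>p. bit (part_color p) k) L) = x (Suc k))"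
    using sorted unfolding B_set_def colors mem_Collect_eq well_spaced_iff by blast
  have "(\<forall>i j. i < j \<and> j < length L \<and> part_size (L ! i) \<ge> part_size (L ! j)
         \<and> odd (part_color (L ! i)) \<and> odd (part_color (L ! j)) \<longrightarrow>
       part_size (L ! i) \<ge> part_size (L ! j) + M + (\<Sum>l = i..<j. \<omega>\<^sub>e (part_color (L ! l))))
     \<longleftrightarrow> parts_differ_by M (odd_parts L)" if L: "well_spaced n L"
    unfolding odd_gaps_iff[OF L]
    using well_spaced_sorted[OF L] unfolding sorted_wrt_iff_nth_less by (meson less_imp_le)
  then show ?thesis unfolding BM_set_def mem_Collect_eq B by blast
qed

section \<open>Words with prescribed numbers of letters\<close>

definition words :: "nat \<Rightarrow> nat \<Rightarrow> nat \<Rightarrow> (nat \<Rightarrow> nat) \<Rightarrow> nat \<Rightarrow> nat list set" where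
  "words N n M x l = {w. length w = l \<and> set w \<subseteq> {..<n} \<union> {N}
     \<and> (\<forall>k<n. count_list w k = x (Suc k)) \<and> parts_differ_by M (zero_parts N w)}"

lemma finite_words: "finite (words N n M x l)"
  by (rule finite_subset[OF _ finite_lists_length_eq[of "{..<n} \<union> {N}" l]])
    (auto simp: words_def)

text \<open>A length of at least \<open>m\<close> leaves room for every colored partition of \<open>m\<close>, since the first part
  is at most \<open>m\<close>.\<close>
lemma card_words:
  assumes "1 \<le> n" "n \<le> N" "m \<le> l"
  shows "card {w \<in> words N n M x l. break_weight N (N # w) = m} = BM_count n M x m"
  unfolding BM_count_def
proof (rule bij_betw_same_card[of "runs N"], rule bij_betwI')
  have sub: "set w \<subseteq> {..N}" if "set w \<subseteq> {..<n} \<union> {N}" for w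
    using that assms(2) by (auto dest!: subsetD)
  {
    fix u w assume "u \<in> {w \<in> words N n M x l. break_weight N (N # w) = m}"
      "w \<in> {w \<in> words N n M x l. break_weight N (N # w) = m}"
    then have "length u = length w" "set u \<subseteq> {..N}" "set w \<subseteq> {..N}"
      using sub by (simp_all add: words_def)
    then show "runs N u = runs N w \<longleftrightarrow> u = w" using runs_inject by blast
  }
  have mem: "runs N w \<in> BM_set n M x m \<longleftrightarrow> w \<in> words N n M x l \<and> break_weight N (N # w) = m"
    if "length w = l" "set w \<subseteq> {..<n} \<union> {N}" for w
  proof -
    have "odd_parts (runs N w) = zero_parts N w" using odd_parts_runs sub[OF that(2)] assms by simp
    moreover have "sum_list (map part_size (runs N w)) = break_weight N (N # w)"
      by (rule sum_list_runs[OF sub[OF that(2)]])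
    moreover have "length (filter (\<lambda>p. bit (part_color p) k) (runs N w)) = count_list w k"
      if "k < n" for k using count_runs that assms by simp
    moreover have "well_spaced n (runs N w)" by (rule well_spaced_runs[OF assms(2) that(2)])
    ultimately show ?thesis using that unfolding BM_set_iff words_def by auto
  qed
  {
    fix w assume "w \<in> {w \<in> words N n M x l. break_weight N (N # w) = m}"
    then show "runs N w \<in> BM_set n M x m" using mem by (simp add: words_def)
  }
  {
    fix L assume L: "L \<in> BM_set n M x m"
    then have "well_spaced n L" and sum: "sum_list (map part_size L) = m" by (auto simp: BM_set_iff)
    moreover have "L \<noteq> [] \<longrightarrow> part_size (hd L) \<le> l" using sum assms(3) by (cases L) auto
    ultimately obtain w where w: "length w = l" "set w \<subseteq> {..<n} \<union> {N}" "runs N w = L"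
      using runs_surj[OF assms(2)] by blast
    then show "\<exists>w\<in>{w \<in> words N n M x l. break_weight N (N # w) = m}. L = runs N w"
      using L mem[of w] by auto
  }
qed

text \<open>The insertions of the letter \<open>n\<close> do not affect the subword of zeros and bars, because \<open>n\<close>
  is neither.\<close>
lemma words_Suc:
  assumes "1 \<le> n" "n < N"
  shows "words N (Suc n) M x (l + x (Suc n)) = (\<Union>w\<in>words N n M x l. insertions n w (x (Suc n)))"
proof (intro equalityI subsetI)
  fix u assume u: "u \<in> words N (Suc n) M x (l + x (Suc n))"
  define w where "w = filter (\<lambda>a. a \<noteq> n) u"
  have "length w + count_list u n = length u"
    unfolding w_def count_list_eq_length_filter
    using sum_length_filter_compl[of "(=) n" u] by (simp add: eq_commute add.commute)
  then have len: "length w = l" "length u = length w + x (Suc n)"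
    using u by (auto simp: words_def)
  have "count_list w k = count_list u k" if "k < n" for k
    using that by (auto simp: w_def count_list_eq_length_filter intro!: arg_cong[of _ _ length] filter_cong)
  moreover have "set w \<subseteq> {..<n} \<union> {N}" using u by (auto simp: w_def words_def)
  moreover have "zero_parts N w = zero_parts N u"
    unfolding w_def using assms by (intro zero_parts_filter) auto
  ultimately have "w \<in> words N n M x l" using u len by (auto simp: words_def)
  moreover have "u \<in> insertions n w (x (Suc n))" using len w_def by (simp add: insertions_def)
  ultimately show "u \<in> (\<Union>w\<in>words N n M x l. insertions n w (x (Suc n)))" by blast
next
  fix u assume "u \<in> (\<Union>w\<in>words N n M x l. insertions n w (x (Suc n)))"
  then obtain w where w: "w \<in> words N n M x l" "filter (\<lambda>a. a \<noteq> n) u = w"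
    "length u = length w + x (Suc n)" by (auto simp: insertions_def)
  have "length w + count_list u n = length u"
    unfolding w(2)[symmetric] count_list_eq_length_filter
    using sum_length_filter_compl[of "(=) n" u] by (simp add: eq_commute add.commute)
  then have "count_list u n = x (Suc n)" using w(3) by simp
  moreover have "count_list w k = count_list u k" if "k < n" for k
    unfolding w(2)[symmetric] using that
    by (auto simp: count_list_eq_length_filter intro!: arg_cong[of _ _ length] filter_cong)
  moreover have "set u \<subseteq> insert n (set w)" unfolding w(2)[symmetric] by auto
  moreover have "zero_parts N w = zero_parts N u"
    unfolding w(2)[symmetric] using assms by (intro zero_parts_filter) auto
  ultimately show "u \<in> words N (Suc n) M x (l + x (Suc n))"
    using w by (auto simp: words_def less_Suc_eq)
qed

lemma sum_words_Suc:
  fixes q :: "'a::comm_semiring_1"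
  assumes "1 \<le> n" "n < N"
  shows "(\<Sum>u\<in>words N (Suc n) M x (l + x (Suc n)). q ^ break_weight N (N # u))
    = (\<Sum>w\<in>words N n M x l. q ^ break_weight N (N # w))
      * (\<Sum>\<mu>\<in>strict_lists (l + x (Suc n)) (x (Suc n)). q ^ sum_list \<mu>)"
proof -
  let ?t = "x (Suc n)"
  have "(\<Sum>u\<in>words N (Suc n) M x (l + ?t). q ^ break_weight N (N # u))
      = (\<Sum>w\<in>words N n M x l. \<Sum>u\<in>insertions n w ?t. q ^ break_weight N (N # u))"
    unfolding words_Suc[OF assms]
    by (intro sum.UNION_disjoint finite_words ballI finite_insertions impI) (auto simp: insertions_def)
  also have "\<dots> = (\<Sum>w\<in>words N n M x l.
      q ^ break_weight N (N # w) * (q ^ ?t * power_esym q (l + ?t) ?t))"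
  proof (rule sum.cong)
    fix w assume w: "w \<in> words N n M x l"
    then have "\<forall>b\<in>set w. b < n \<or> b = N" "length w = l" by (auto simp: words_def)
    then show "(\<Sum>u\<in>insertions n w ?t. q ^ break_weight N (N # u))
        = q ^ break_weight N (N # w) * (q ^ ?t * power_esym q (l + ?t) ?t)"
      using sum_insertions[OF assms(2), of w N q ?t] assms(2)
      by (simp only: power_add mult.assoc if_True less_imp_le order.refl)
  qed simp
  finally show ?thesis by (simp only: sum_strict_lists sum_distrib_right)
qed

section \<open>The common recursion in the number of colors\<close>

lemma coeff_sum_powers:
  assumes "finite S"
  shows "coeff (\<Sum>s\<in>S. monom (1::nat) 1 ^ f s) m = card {s \<in> S. f s = m}"
proof -
  have "coeff (\<Sum>s\<in>S. monom (1::nat) 1 ^ f s) m = (\<Sum>s\<in>S. if f s = m then 1 else 0)"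
    by (simp add: coeff_sum monom_power cong: if_cong)
  also have "\<dots> = card {s \<in> S. f s = m}"
    using assms by (simp add: sum.If_cases Int_def)
  finally show ?thesis .
qed

lemma strict_partition_iff:
  "is_partition \<mu> \<and> distinct \<mu> \<longleftrightarrow> sorted_wrt (>) \<mu> \<and> (\<forall>p\<in>set \<mu>. 0 < p)"
proof -
  have "sorted_wrt (\<ge>) \<mu> \<and> distinct \<mu> \<longleftrightarrow> sorted_wrt (>) \<mu>"
    by (induction \<mu>) (auto simp: le_less)
  then show ?thesis by (auto simp: is_partition_def)
qed

definition strict_partitions :: "nat \<Rightarrow> nat \<Rightarrow> nat list set" where
  "strict_partitions t m = {\<mu>. is_partition \<mu> \<and> distinct \<mu> \<and> length \<mu> = t \<and> sum_list \<mu> = m}"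

text \<open>A part is at most the sum of all parts.\<close>
lemma strict_partitions_eq:
  assumes "m \<le> h"
  shows "strict_partitions t m = {\<mu> \<in> strict_lists h t. sum_list \<mu> = m}"
proof -
  have "is_partition \<mu> \<and> distinct \<mu> \<longleftrightarrow> sorted_wrt (>) \<mu> \<and> set \<mu> \<subseteq> {1..h}"
    if "sum_list \<mu> = m" for \<mu>
  proof -
    have "\<mu> ! i \<le> h" if "i < length \<mu>" for i
      using elem_le_sum_list[OF that] \<open>sum_list \<mu> = m\<close> assms by simp
    then have "\<forall>p\<in>set \<mu>. p \<le> h" by (auto simp: in_set_conv_nth)
    then show ?thesis unfolding strict_partition_iff by (force simp: Suc_le_eq)
  qed
  then show ?thesis by (auto simp: strict_partitions_def strict_lists_def)
qed

text \<open>The coefficient of \<open>q ^ m\<close> in \<open>sum_words_Suc\<close>, where \<open>m \<le> l\<close> makes the bound on the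
  parts of the partitions vacuous.\<close>
lemma card_words_Suc:
  assumes "1 \<le> n" "n < N" "m \<le> l"
  shows "card {u \<in> words N (Suc n) M x (l + x (Suc n)). break_weight N (N # u) = m}
    = (\<Sum>j\<le>m. card {w \<in> words N n M x l. break_weight N (N # w) = j}
        * card (strict_partitions (x (Suc n)) (m - j)))"
proof -
  have "card (strict_partitions (x (Suc n)) (m - j))
      = card {\<mu> \<in> strict_lists (l + x (Suc n)) (x (Suc n)). sum_list \<mu> = m - j}" for j
    using assms(3) by (subst strict_partitions_eq[of _ "l + x (Suc n)"]) auto
  then show ?thesis
    using arg_cong[OF sum_words_Suc[OF assms(1,2),
        where q = "monom (1::nat) 1" and M = M and x = x and l = l], of "\<lambda>p. coeff p m"]
    unfolding coeff_mult coeff_sum_powers[OF finite_words] coeff_sum_powers[OF finite_strict_lists]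
    by simp
qed

lemma finite_strict_partitions: "finite (strict_partitions t m)"
  by (simp add: strict_partitions_eq[of m m] finite_strict_lists)

lemma A_set_1:
  "A_set 1 M x m = (\<lambda>\<mu>. [\<mu>]) ` {\<mu> \<in> strict_partitions (x 1) m. parts_differ_by M \<mu>}"
proof (intro equalityI subsetI)
  fix \<mu>s assume "\<mu>s \<in> A_set 1 M x m"
  then show "\<mu>s \<in> (\<lambda>\<mu>. [\<mu>]) ` {\<mu> \<in> strict_partitions (x 1) m. parts_differ_by M \<mu>}"
    by (cases \<mu>s) (auto simp: A_set_def strict_partitions_def)
qed (auto simp: A_set_def strict_partitions_def)

lemma A_set_Suc:
  assumes "1 \<le> n"
  shows "A_set (Suc n) M x m = (\<lambda>(j, \<mu>s, \<mu>). \<mu>s @ [\<mu>]) `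
    (SIGMA j:{..m}. A_set n M x j \<times> strict_partitions (x (Suc n)) (m - j))"
proof (intro equalityI subsetI)
  fix \<mu>s assume A: "\<mu>s \<in> A_set (Suc n) M x m"
  then obtain \<nu>s \<nu> where \<mu>s: "\<mu>s = \<nu>s @ [\<nu>]" "length \<nu>s = n"
    by (cases \<mu>s rule: rev_cases) (auto simp: A_set_def)
  have nth: "\<mu>s ! (r - 1) = \<nu>s ! (r - 1)" if "r \<in> {1..n}" for r
    using that \<mu>s by (auto simp: nth_append)
  have "\<mu>s ! 0 = \<nu>s ! 0" "\<mu>s ! n = \<nu>" using assms \<mu>s by (auto simp: nth_append)
  moreover have "(\<Sum>r = 1..n. sum_list (\<nu>s ! (r - 1))) + sum_list \<nu> = m"
    using A nth \<open>\<mu>s ! n = \<nu>\<close> by (simp add: A_set_def)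
  moreover have "\<forall>r\<in>{1..n}. is_partition (\<nu>s ! (r - 1)) \<and> distinct (\<nu>s ! (r - 1))
                     \<and> length (\<nu>s ! (r - 1)) = x r"
  proof
    fix r assume r: "r \<in> {1..n}"
    then have "r \<in> {1..Suc n}" by simp
    then have "is_partition (\<mu>s ! (r - 1)) \<and> distinct (\<mu>s ! (r - 1)) \<and> length (\<mu>s ! (r - 1)) = x r"
      using A unfolding A_set_def by blast
    then show "is_partition (\<nu>s ! (r - 1)) \<and> distinct (\<nu>s ! (r - 1)) \<and> length (\<nu>s ! (r - 1)) = x r"
      unfolding nth[OF r] .
  qed
  moreover have "is_partition \<nu> \<and> distinct \<nu> \<and> length \<nu> = x (Suc n)"
    using A \<open>\<mu>s ! n = \<nu>\<close> by (auto simp: A_set_def dest: bspec[of _ _ "Suc n"])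
  ultimately have "(\<Sum>r = 1..n. sum_list (\<nu>s ! (r - 1))) \<le> m"
      "\<nu>s \<in> A_set n M x (\<Sum>r = 1..n. sum_list (\<nu>s ! (r - 1)))"
      "\<nu> \<in> strict_partitions (x (Suc n)) (m - (\<Sum>r = 1..n. sum_list (\<nu>s ! (r - 1))))"
    using A \<mu>s(2) by (auto simp: A_set_def strict_partitions_def)
  then show "\<mu>s \<in> (\<lambda>(j, \<mu>s, \<mu>). \<mu>s @ [\<mu>]) `
    (SIGMA j:{..m}. A_set n M x j \<times> strict_partitions (x (Suc n)) (m - j))"
    unfolding \<mu>s(1) by (intro image_eqI[of _ _ "(\<Sum>r = 1..n. sum_list (\<nu>s ! (r - 1)), \<nu>s, \<nu>)"]) auto
next
  fix \<mu>s assume "\<mu>s \<in> (\<lambda>(j, \<mu>s, \<mu>). \<mu>s @ [\<mu>]) `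
    (SIGMA j:{..m}. A_set n M x j \<times> strict_partitions (x (Suc n)) (m - j))"
  then obtain j \<nu>s \<nu> where \<mu>s: "\<mu>s = \<nu>s @ [\<nu>]" "j \<le> m" "\<nu>s \<in> A_set n M x j"
    "\<nu> \<in> strict_partitions (x (Suc n)) (m - j)" by auto
  then have len: "length \<nu>s = n" by (simp add: A_set_def)
  have nth: "\<mu>s ! (r - 1) = \<nu>s ! (r - 1)" if "r \<in> {1..n}" for r
    using that \<mu>s len by (auto simp: nth_append)
  have last: "\<mu>s ! 0 = \<nu>s ! 0" "\<mu>s ! n = \<nu>" using assms \<mu>s len by (auto simp: nth_append)
  have "(\<Sum>r = 1..Suc n. sum_list (\<mu>s ! (r - 1))) = (\<Sum>r = 1..n. sum_list (\<nu>s ! (r - 1))) + sum_list \<nu>"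
    using nth last by simp
  also have "\<dots> = m" using \<mu>s by (simp add: A_set_def strict_partitions_def)
  finally show "\<mu>s \<in> A_set (Suc n) M x m"
    using \<mu>s(3,4) nth last len \<mu>s(1)
    by (auto simp: A_set_def strict_partitions_def atLeastAtMostSuc_conv)
qed

lemma finite_A_set: "1 \<le> n \<Longrightarrow> finite (A_set n M x m)"
proof (induction n arbitrary: m rule: nat_induct_at_least)
  case base
  show ?case by (simp add: A_set_1[simplified] finite_strict_partitions)
next
  case (Suc n)
  then show ?case
    unfolding A_set_Suc[OF Suc(1)]
    by (intro finite_imageI finite_SigmaI) (auto simp: finite_strict_partitions)
qed

lemma A_count_Suc:
  assumes "1 \<le> n"
  shows "A_count (Suc n) M x m
    = (\<Sum>j\<le>m. A_count n M x j * card (strict_partitions (x (Suc n)) (m - j)))"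
proof -
  have "inj_on (\<lambda>(j, \<mu>s, \<mu>). \<mu>s @ [\<mu>])
      (SIGMA j:{..m}. A_set n M x j \<times> strict_partitions (x (Suc n)) (m - j))"
    by (auto simp: inj_on_def A_set_def)
  then show ?thesis
    unfolding A_count_def A_set_Suc[OF assms]
    by (subst card_image, assumption, subst card_SigmaI)
      (auto simp: finite_A_set[OF assms] finite_strict_partitions card_cartesian_product)
qed

lemma well_spaced_1_iff: "well_spaced 1 (map (\<lambda>s. (s, 1)) \<mu>) \<longleftrightarrow> is_partition \<mu> \<and> distinct \<mu>"
  unfolding strict_partition_iff
proof (induction \<mu>)
  case (Cons a \<mu>)
  have one: "\<omega> 1 = 1" "\<delta> 1 1 = 0"
    using \<omega>_exp[of 0] v_exp[of 0] z_exp[of 0] by (auto simp: \<delta>_def)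
  show ?case
  proof (cases \<mu>)
    case Nil
    then show ?thesis using one by auto
  next
    case \<mu>: (Cons b \<mu>')
    have "well_spaced 1 (map (\<lambda>s. (s, 1)) (a # \<mu>)) \<longleftrightarrow> b < a \<and> well_spaced 1 (map (\<lambda>s. (s, 1)) \<mu>)"
      using one by (auto simp: \<mu>)
    moreover have "sorted_wrt (>) (a # \<mu>) \<longleftrightarrow> b < a \<and> sorted_wrt (>) \<mu>"
      unfolding \<mu> by (rule sorted_wrt2) (auto intro: transpI)
    ultimately show ?thesis using Cons.IH by (auto simp: \<mu>)
  qed
qed simp

lemma odd_parts_1: "odd_parts (map (\<lambda>s. (s, 1)) \<mu>) = \<mu>"
proof -
  have "\<omega>\<^sub>e 1 = 0" using \<omega>\<^sub>e_exp[of 0] by simp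
  then show ?thesis by (induction \<mu>) (simp_all add: comp_def)
qed

text \<open>With the single color \<open>1\<close>, the colored partitions are partitions into distinct parts,
  as \<open>\<omega>(1) = 1\<close>, \<open>\<delta>(1, 1) = 0\<close> and \<open>\<omega>\<^sub>e(1) = 0\<close>.\<close>
lemma BM_count_1: "BM_count 1 M x m = A_count 1 M x m"
proof -
  let ?S = "{\<mu> \<in> strict_partitions (x 1) m. parts_differ_by M \<mu>}"
  have mem: "map (\<lambda>s. (s, 1)) \<mu> \<in> BM_set 1 M x m \<longleftrightarrow> \<mu> \<in> ?S" for \<mu>
  proof -
    have "map part_size (map (\<lambda>s. (s, 1::nat)) \<mu>) = \<mu>" by (induction \<mu>) auto
    moreover have "length (filter (\<lambda>p. bit (part_color p) 0) (map (\<lambda>s. (s, 1)) \<mu>)) = length \<mu>"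
      by (induction \<mu>) (auto simp: bit_0)
    ultimately show ?thesis
      unfolding BM_set_iff well_spaced_1_iff odd_parts_1 by (auto simp: strict_partitions_def)
  qed
  have "BM_set 1 M x m = map (\<lambda>s. (s, 1)) ` ?S"
  proof (intro equalityI subsetI)
    fix L assume L: "L \<in> BM_set 1 M x m"
    then have "well_spaced 1 L" by (simp add: BM_set_iff)
    then have "\<forall>p\<in>set L. part_color p = 1" unfolding well_spaced_iff by force
    then have "map (\<lambda>s. (s, 1)) (map part_size L) = L" by (induction L) auto
    then show "L \<in> map (\<lambda>s. (s, 1)) ` ?S" using mem[of "map part_size L"] L by (metis imageI)
  qed (use mem in blast)
  moreover have "inj_on (map (\<lambda>s. (s, 1::nat))) ?S"
    by (intro inj_on_subset[OF inj_mapI subset_UNIV] injI) simp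
  moreover have "inj_on (\<lambda>\<mu>. [\<mu>]) ?S" by (simp add: inj_on_def)
  ultimately show ?thesis
    unfolding BM_count_def A_count_def A_set_1 by (simp only: card_image)
qed

text \<open>The words considered have \<open>K\<close> bars. The number of bars has to be the same for all \<open>n\<close> in the
  induction, while the length grows with every color.\<close>
lemma card_words_eq_A_count:
  assumes "1 \<le> n" "n \<le> N" "m \<le> K"
  shows "card {w \<in> words N n M x (K + (\<Sum>k<n. x (Suc k))). break_weight N (N # w) = m} = A_count n M x m"
  using assms
proof (induction n arbitrary: m rule: nat_induct_at_least)
  case base
  then have "m \<le> K + (\<Sum>k<1. x (Suc k))" by simp
  from card_words[OF _ base(1) this] show ?case unfolding BM_count_1 by simp
next
  case (Suc n)
  let ?l = "K + (\<Sum>k<n. x (Suc k))"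
  have l: "K + (\<Sum>k<Suc n. x (Suc k)) = ?l + x (Suc n)" by simp
  have "card {w \<in> words N n M x ?l. break_weight N (N # w) = j} = A_count n M x j" if "j \<le> m" for j
    using Suc.IH[of j] that Suc.prems by simp
  then show ?case
    unfolding l A_count_Suc[OF Suc.hyps]
    using card_words_Suc[of n N m ?l M x] Suc.hyps Suc.prems by simp
qed

text \<open>Words with \<open>m\<close> bars are long enough for both counts, and \<open>n\<close> itself can serve as the bar.\<close>
theorem theorem4:
  fixes n M m :: nat and x :: "nat \<Rightarrow> nat"
  assumes "n \<ge> 1" and "M \<ge> 1"
  shows "A_count n M x m = BM_count n M x m"
proof -
  let ?l = "m + (\<Sum>k<n. x (Suc k))"
  have "A_count n M x m = card {w \<in> words n n M x ?l. break_weight n (n # w) = m}"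
    using card_words_eq_A_count[OF assms(1) order.refl order.refl] by simp
  also have "\<dots> = BM_count n M x m" using card_words[OF assms(1) order.refl] by simp
  finally show ?thesis .
qed

end
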